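(* Let $G$ be a finite group, let $\mathbb{F}$ be a field of characteristic zero, and let $V$ be a finite-dimensional vector space over $\mathbb{F}$. If $\rho : G \to GL(V)$ is a reducible representation of $G$, then the representation $\psi : \mathcal{L}(G) \to \mathfrak{gl}(V)$ of the Plesken Lie algebra $\mathcal{L}(G)$ over $\mathbb{F}$ defined by $$\psi\Big(\sum_{i=1}^n a_i \hat{g_i}\Big) = \sum_{i=1}^n a_i \widehat{\rho(g_i)}, \qquad a_i \in \mathbb{F},$$ is also reducible.
   Context: Write $G=\{g_1,\dots,g_n\}$. The group algebra $\mathbb{F}G$ is the $\mathbb{F}$-vector space with basis $G$ and multiplication extending that of $G$ bilinearly. For $g\in G$ put $\hat g = g - g^{-1}\in \mathbb{F}G$. The Plesken Lie algebra $\mathcal{L}(G)$ of $G$ over $\mathbb{F}$ is the $\mathbb{F}$-linear span of the elements $\hat g$ ($g\in G$) in $\mathbb{F}G$, with Lie bracket $[\hat g,\hat h]=\hat g\hat h-\hat h\hat g$ extended bilinearly. $\mathfrak{gl}(V)$ is the Lie algebra of all linear endomorphisms of $V$ with the commutator bracket. For $T\in GL(V)$, $\widehat{T}=T-T^{-1}\in\mathfrak{gl}(V)$, so $\widehat{\rho(g)}=\rho(g)-\rho(g^{-1})$. A representation of $\mathcal{L}(G)$ on $V$ is a Lie algebra homomorphism $\mathcal{L}(G)\to\mathfrak{gl}(V)$; the map $\psi$ above is well defined and is such a representation. A representation of $G$ (respectively of $\mathcal{L}(G)$) on $V$ is reducible if there is a subspace $W$ of $V$ with $\{0\}\neq W\neq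 V$ that is invariant under all operators $\rho(g)$, $g\in G$ (respectively $\psi(\hat x)$, $\hat x\in\mathcal{L}(G)$). *)

theory Defs
  imports Complex_Main "HOL-Library.Function_Algebras" "HOL-Algebra.Group"
begin

text \<open>
  Functions into a vector space form a vector space under pointwise operations. This is used both
  for the group algebra (functions into the field) and for endomorphisms.
\<close>

definition fun_scale :: "('f \<Rightarrow> 'v \<Rightarrow> 'v) \<Rightarrow> 'f \<Rightarrow> ('x \<Rightarrow> 'v) \<Rightarrow> 'x \<Rightarrow> 'v" where
  "fun_scale s c f = (\<lambda>x. s c (f x))"

definition commutator :: "('a \<Rightarrow> 'a \<Rightarrow> 'a::ab_group_add) \<Rightarrow> 'a \<Rightarrow> 'a \<Rightarrow> 'a" where
  "commutator m x y = m x y - m y x"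

locale lie_algebra = vector_space scale
  for scale :: "'f::field \<Rightarrow> 'a::ab_group_add \<Rightarrow> 'a" +
  fixes L :: "'a set" and br :: "'a \<Rightarrow> 'a \<Rightarrow> 'a"
  assumes subspace_L: "subspace L"
    and br_closed: "\<lbrakk>x \<in> L; y \<in> L\<rbrakk> \<Longrightarrow> br x y \<in> L"
    and br_add_left: "\<lbrakk>x \<in> L; y \<in> L; z \<in> L\<rbrakk> \<Longrightarrow> br (x + y) z = br x z + br y z"
    and br_add_right: "\<lbrakk>x \<in> L; y \<in> L; z \<in> L\<rbrakk> \<Longrightarrow> br x (y + z) = br x y + br x z"
    and br_scale_left: "\<lbrakk>x \<in> L; y \<in> L\<rbrakk> \<Longrightarrow> br (scale c x) y = scale c (br x y)"
    and br_scale_right: "\<lbrakk>x \<in> L; y \<in> L\<rbrakk> \<Longrightarrow> br x (scale c y) = scale c (br x y)"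
    and br_alternating: "x \<in> L \<Longrightarrow> br x x = 0"
    and jacobi: "\<lbrakk>x \<in> L; y \<in> L; z \<in> L\<rbrakk> \<Longrightarrow> br x (br y z) + br y (br z x) + br z (br x y) = 0"

locale lie_algebra_hom = A: lie_algebra s1 L1 br1 + B: lie_algebra s2 L2 br2
  for s1 :: "'f::field \<Rightarrow> 'a::ab_group_add \<Rightarrow> 'a" and L1 br1
    and s2 :: "'f \<Rightarrow> 'b::ab_group_add \<Rightarrow> 'b" and L2 br2 +
  fixes \<phi> :: "'a \<Rightarrow> 'b"
  assumes hom_closed: "x \<in> L1 \<Longrightarrow> \<phi> x \<in> L2"
    and hom_add: "\<lbrakk>x \<in> L1; y \<in> L1\<rbrakk> \<Longrightarrow> \<phi> (x + y) = \<phi> x + \<phi> y"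
    and hom_scale: "x \<in> L1 \<Longrightarrow> \<phi> (s1 c x) = s2 c (\<phi> x)"
    and hom_br: "\<lbrakk>x \<in> L1; y \<in> L1\<rbrakk> \<Longrightarrow> \<phi> (br1 x y) = br2 (\<phi> x) (\<phi> y)"


section \<open>Linear operators and representations\<close>

text \<open>The vector space \<open>V\<close> is the whole type \<open>'v\<close> with scalar multiplication \<open>s\<close>.\<close>

definition general_linear_group ::
    "('f::field \<Rightarrow> 'v::ab_group_add \<Rightarrow> 'v) \<Rightarrow> ('v \<Rightarrow> 'v) monoid" where
  "general_linear_group s =
     \<lparr>carrier = {T. Vector_Spaces.linear s s T \<and> bij T}, mult = (\<circ>), one = id\<rparr>"

definition gl :: "('f::field \<Rightarrow> 'v::ab_group_add \<Rightarrow> 'v) \<Rightarrow> ('v \<Rightarrow> 'v) set" where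
  "gl s = {T. Vector_Spaces.linear s s T}"

definition GL_hat :: "('f::field \<Rightarrow> 'v::ab_group_add \<Rightarrow> 'v) \<Rightarrow> ('v \<Rightarrow> 'v) \<Rightarrow> 'v \<Rightarrow> 'v" where
  "GL_hat s T = T - inv\<^bsub>general_linear_group s\<^esub> T"

definition group_representation ::
    "('g, 'm) monoid_scheme \<Rightarrow> ('f::field \<Rightarrow> 'v::ab_group_add \<Rightarrow> 'v) \<Rightarrow> ('g \<Rightarrow> 'v \<Rightarrow> 'v) \<Rightarrow> bool" where
  "group_representation G s \<rho> \<longleftrightarrow> \<rho> \<in> hom G (general_linear_group s)"

definition lie_representation ::
    "('f::field \<Rightarrow> 'a::ab_group_add \<Rightarrow> 'a) \<Rightarrow> 'a set \<Rightarrow> ('a \<Rightarrow> 'a \<Rightarrow> 'a)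
      \<Rightarrow> ('f \<Rightarrow> 'v::ab_group_add \<Rightarrow> 'v) \<Rightarrow> ('a \<Rightarrow> 'v \<Rightarrow> 'v) \<Rightarrow> bool" where
  "lie_representation sL L br s \<psi> \<longleftrightarrow>
     lie_algebra_hom sL L br (fun_scale s) (gl s) (commutator (\<circ>)) \<psi>"

definition invariant_subspace ::
    "('f::field \<Rightarrow> 'v::ab_group_add \<Rightarrow> 'v) \<Rightarrow> ('v \<Rightarrow> 'v) set \<Rightarrow> 'v set \<Rightarrow> bool" where
  "invariant_subspace s Ops W \<longleftrightarrow> module.subspace s W \<and> (\<forall>T\<in>Ops. T ` W \<subseteq> W)"

definition reducible_group_representation ::
    "('g, 'm) monoid_scheme \<Rightarrow> ('f::field \<Rightarrow> 'v::ab_group_add \<Rightarrow> 'v) \<Rightarrow> ('g \<Rightarrow> 'v \<Rightarrow> 'v) \<Rightarrow> bool" where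
  "reducible_group_representation G s \<rho> \<longleftrightarrow>
     group_representation G s \<rho> \<and>
     (\<exists>W. invariant_subspace s (\<rho> ` carrier G) W \<and> W \<noteq> {0} \<and> W \<noteq> UNIV)"

definition reducible_lie_representation ::
    "('f::field \<Rightarrow> 'a::ab_group_add \<Rightarrow> 'a) \<Rightarrow> 'a set \<Rightarrow> ('a \<Rightarrow> 'a \<Rightarrow> 'a)
      \<Rightarrow> ('f \<Rightarrow> 'v::ab_group_add \<Rightarrow> 'v) \<Rightarrow> ('a \<Rightarrow> 'v \<Rightarrow> 'v) \<Rightarrow> bool" where
  "reducible_lie_representation sL L br s \<psi> \<longleftrightarrow>
     lie_representation sL L br s \<psi> \<and>
     (\<exists>W. invariant_subspace s (\<psi> ` L) W \<and> W \<noteq> {0} \<and> W \<noteq> UNIV)"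


section \<open>The group algebra and the Plesken Lie algebra\<close>

text \<open>
  An element of the group algebra of a finite group is its coefficient function, taken to be zero
  outside the carrier; \<open>group_elem g\<close> is the basis vector \<open>g\<close>.
\<close>

abbreviation ga_scale :: "'f::field \<Rightarrow> ('g \<Rightarrow> 'f) \<Rightarrow> 'g \<Rightarrow> 'f" where
  "ga_scale \<equiv> fun_scale (*)"

definition group_elem :: "'g \<Rightarrow> 'g \<Rightarrow> 'f::field" where
  "group_elem g = (\<lambda>h. if h = g then 1 else 0)"

definition group_algebra :: "('g, 'm) monoid_scheme \<Rightarrow> ('g \<Rightarrow> 'f::field) set" where
  "group_algebra G = {x. \<forall>g. g \<notin> carrier G \<longrightarrow> x g = 0}"

definition ga_mult ::
    "('g, 'm) monoid_scheme \<Rightarrow> ('g \<Rightarrow> 'f::field) \<Rightarrow> ('g \<Rightarrow> 'f) \<Rightarrow> 'g \<Rightarrow> 'f" where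
  "ga_mult G x y =
     (\<Sum>g\<in>carrier G. \<Sum>h\<in>carrier G. ga_scale (x g * y h) (group_elem (g \<otimes>\<^bsub>G\<^esub> h)))"

definition group_hat :: "('g, 'm) monoid_scheme \<Rightarrow> 'g \<Rightarrow> 'g \<Rightarrow> 'f::field" where
  "group_hat G g = group_elem g - group_elem (inv\<^bsub>G\<^esub> g)"

definition plesken :: "('g, 'm) monoid_scheme \<Rightarrow> ('g \<Rightarrow> 'f::field) set" where
  "plesken G = module.span ga_scale (group_hat G ` carrier G)"

definition plesken_bracket ::
    "('g, 'm) monoid_scheme \<Rightarrow> ('g \<Rightarrow> 'f::field) \<Rightarrow> ('g \<Rightarrow> 'f) \<Rightarrow> 'g \<Rightarrow> 'f" where
  "plesken_bracket G = commutator (ga_mult G)"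

text \<open>
  The elements \<open>group_hat G g\<close> are not linearly independent, so the coefficients \<open>a\<close> below are not
  determined by \<open>x\<close>; \<open>plesken_rep_sum\<close> shows that the value is.
\<close>

definition plesken_rep ::
    "('g, 'm) monoid_scheme \<Rightarrow> ('f::field \<Rightarrow> 'v::ab_group_add \<Rightarrow> 'v) \<Rightarrow> ('g \<Rightarrow> 'v \<Rightarrow> 'v)
      \<Rightarrow> ('g \<Rightarrow> 'f) \<Rightarrow> 'v \<Rightarrow> 'v" where
  "plesken_rep G s \<rho> x =
     (THE T. \<exists>a. x = (\<Sum>g\<in>carrier G. ga_scale (a g) (group_hat G g)) \<and>
                 T = (\<Sum>g\<in>carrier G. fun_scale s (a g) (GL_hat s (\<rho> g))))"


section \<open>Well-definedness\<close>

lemma sum_fun_apply: "(\<Sum>i\<in>A. f i) x = (\<Sum>i\<in>A. f i x)"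
  by (induction A rule: infinite_finite_induct) auto

lemma vector_space_fun_scale:
  assumes "vector_space s"
  shows "vector_space (fun_scale s :: 'f::field \<Rightarrow> ('x \<Rightarrow> 'v::ab_group_add) \<Rightarrow> _)"
proof -
  interpret vector_space s by fact
  show ?thesis
    by unfold_locales (auto simp: fun_scale_def scale_right_distrib scale_left_distrib)
qed

lemma vector_space_ga_scale: "vector_space (ga_scale :: 'f::field \<Rightarrow> ('g \<Rightarrow> 'f) \<Rightarrow> _)"
  by (rule vector_space_fun_scale) (unfold_locales, auto simp: algebra_simps)

lemma lie_algebra_commutatorI:
  fixes s :: "'f::field \<Rightarrow> 'a::ab_group_add \<Rightarrow> 'a"
  assumes vs: "vector_space s" and A: "module.subspace s A" and L: "module.subspace s L" "L \<subseteq> A"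
    and cl: "\<And>x y. \<lbrakk>x \<in> A; y \<in> A\<rbrakk> \<Longrightarrow> m x y \<in> A"
    and addl: "\<And>x y z. \<lbrakk>x \<in> A; y \<in> A; z \<in> A\<rbrakk> \<Longrightarrow> m (x + y) z = m x z + m y z"
    and addr: "\<And>x y z. \<lbrakk>x \<in> A; y \<in> A; z \<in> A\<rbrakk> \<Longrightarrow> m x (y + z) = m x y + m x z"
    and scl: "\<And>c x y. \<lbrakk>x \<in> A; y \<in> A\<rbrakk> \<Longrightarrow> m (s c x) y = s c (m x y)"
    and scr: "\<And>c x y. \<lbrakk>x \<in> A; y \<in> A\<rbrakk> \<Longrightarrow> m x (s c y) = s c (m x y)"
    and assoc: "\<And>x y z. \<lbrakk>x \<in> A; y \<in> A; z \<in> A\<rbrakk> \<Longrightarrow> m (m x y) z = m x (m y z)"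
    and clL: "\<And>x y. \<lbrakk>x \<in> L; y \<in> L\<rbrakk> \<Longrightarrow> commutator m x y \<in> L"
  shows "lie_algebra s L (commutator m)"
proof -
  interpret vector_space s by fact
  have dl: "m (x - y) z = m x z - m y z" if "x \<in> A" "y \<in> A" "z \<in> A" for x y z
    using addl[of "x - y" y z] subspace_diff[OF A] that by simp
  have dr: "m x (y - z) = m x y - m x z" if "x \<in> A" "y \<in> A" "z \<in> A" for x y z
    using addr[of x "y - z" z] subspace_diff[OF A] that by simp
  have LA: "x \<in> A" if "x \<in> L" for x
    using L(2) that by blast
  show ?thesis
  proof unfold_locales
    fix x y z assume "x \<in> L" "y \<in> L" "z \<in> L"
    then show "commutator m x (commutator m y z) + commutator m y (commutator m z x)
        + commutator m z (commutator m x y) = 0"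
      by (simp add: commutator_def dl dr cl LA assoc)
  qed (auto simp: commutator_def addl addr scl scr LA L scale_right_diff_distrib
         clL[unfolded commutator_def])
qed

lemma lie_algebra_gl:
  assumes "vector_space s"
  shows "lie_algebra (fun_scale s) (gl s) (commutator (\<circ>))"
proof -
  interpret V: vector_space s by fact
  interpret E: vector_space "fun_scale s :: _ \<Rightarrow> ('b \<Rightarrow> 'b) \<Rightarrow> _"
    by (rule vector_space_fun_scale) fact
  have lin: "x \<in> gl s \<longleftrightarrow> (\<forall>u v. x (u + v) = x u + x v) \<and> (\<forall>c u. x (s c u) = s c (x u))" for x
    using assms by (auto simp: gl_def Vector_Spaces.linear_iff)
  have A: "E.subspace (gl s)"
    by (rule E.subspaceI)
      (auto simp: lin fun_scale_def V.scale_right_distrib V.scale_left_commute algebra_simps)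
  have cl: "x \<circ> y \<in> gl s" if "x \<in> gl s" "y \<in> gl s" for x y
    using that by (auto simp: lin)
  show ?thesis
  proof (rule lie_algebra_commutatorI[OF _ A A order_refl])
    show "vector_space (fun_scale s :: _ \<Rightarrow> ('b \<Rightarrow> 'b) \<Rightarrow> _)"
      by unfold_locales
    show "commutator (\<circ>) x y \<in> gl s" if "x \<in> gl s" "y \<in> gl s" for x y
      unfolding commutator_def by (intro E.subspace_diff[OF A] cl that)
  qed (auto simp: cl lin fun_scale_def fun_eq_iff)
qed

lemma ga_mult_add_left: "ga_mult G (x + y) z = ga_mult G x z + ga_mult G y z"
  by (simp add: ga_mult_def fun_scale_def fun_eq_iff sum_fun_apply distrib_right sum.distrib)

lemma ga_mult_add_right: "ga_mult G x (y + z) = ga_mult G x y + ga_mult G x z"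
  by (simp add: ga_mult_def fun_scale_def fun_eq_iff sum_fun_apply distrib_right distrib_left
      sum.distrib)

lemma ga_mult_scale_left: "ga_mult G (ga_scale c x) y = ga_scale c (ga_mult G x y)"
  by (simp add: ga_mult_def fun_scale_def fun_eq_iff sum_fun_apply sum_distrib_left mult.assoc)

lemma ga_mult_scale_right: "ga_mult G x (ga_scale c y) = ga_scale c (ga_mult G x y)"
  by (simp add: ga_mult_def fun_scale_def fun_eq_iff sum_fun_apply sum_distrib_left
      mult.assoc mult.left_commute)

text \<open>Linear extension of a map on the group to the group algebra.\<close>

definition ga_extend ::
    "('g, 'm) monoid_scheme \<Rightarrow> ('f::field \<Rightarrow> 'a::ab_group_add \<Rightarrow> 'a) \<Rightarrow> ('g \<Rightarrow> 'a) \<Rightarrow> ('g \<Rightarrow> 'f) \<Rightarrow> 'a"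
  where "ga_extend G s f x = (\<Sum>g\<in>carrier G. s (x g) (f g))"

lemma linear_ga_extend:
  fixes s :: "'f::field \<Rightarrow> 'a::ab_group_add \<Rightarrow> 'a"
  assumes "vector_space s"
  shows "Vector_Spaces.linear ga_scale s (ga_extend G s f)"
proof -
  interpret vector_space s by fact
  show ?thesis
    using vector_space_ga_scale assms
    by (auto simp: Vector_Spaces.linear_iff ga_extend_def fun_scale_def scale_left_distrib sum.distrib
        scale_sum_right)
qed

lemma ga_extend_elem:
  fixes s :: "'f::field \<Rightarrow> 'a::ab_group_add \<Rightarrow> 'a"
  assumes "vector_space s" "finite (carrier G)" "g \<in> carrier G"
  shows "ga_extend G s f (group_elem g) = f g"
proof -
  interpret vector_space s by fact
  have "ga_extend G s f (group_elem g) = (\<Sum>h\<in>carrier G. if h = g then f g else 0)"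
    unfolding ga_extend_def by (rule sum.cong) (auto simp: group_elem_def)
  then show ?thesis using assms by simp
qed

lemma ga_extend_id:
  assumes "finite (carrier G)" "x \<in> group_algebra G"
  shows "ga_extend G ga_scale group_elem x = x"
proof
  fix h
  have "ga_extend G ga_scale group_elem x h = (\<Sum>g\<in>carrier G. if g = h then x h else 0)"
    unfolding ga_extend_def sum_fun_apply
    by (rule sum.cong) (auto simp: group_elem_def fun_scale_def)
  then show "ga_extend G ga_scale group_elem x h = x h"
    using assms by (auto simp: group_algebra_def)
qed

lemma subspace_group_algebra:
  "module.subspace ga_scale (group_algebra G :: ('g \<Rightarrow> 'f::field) set)"
proof -
  interpret vector_space "ga_scale :: 'f \<Rightarrow> ('g \<Rightarrow> 'f) \<Rightarrow> _" by (rule vector_space_ga_scale)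
  show ?thesis by (rule subspaceI) (auto simp: group_algebra_def fun_scale_def)
qed

context group
begin

lemma group_elem_closed: "g \<in> carrier G \<Longrightarrow> group_elem g \<in> group_algebra G"
  by (auto simp: group_elem_def group_algebra_def)

lemma ga_mult_closed: "ga_mult G x y \<in> group_algebra G"
  unfolding group_algebra_def ga_mult_def
  by (auto simp: sum_fun_apply fun_scale_def group_elem_def intro!: sum.neutral)

lemma ga_extend_mult:
  fixes s :: "'f::field \<Rightarrow> 'w::ab_group_add \<Rightarrow> 'w"
  assumes "vector_space s" "finite (carrier G)"
  shows "ga_extend G s f (ga_mult G x y) =
    (\<Sum>g\<in>carrier G. \<Sum>h\<in>carrier G. s (x g * y h) (f (g \<otimes> h)))"
proof -
  interpret Vector_Spaces.linear ga_scale s "ga_extend G s f" using assms(1) by (rule linear_ga_extend)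
  show ?thesis
    unfolding ga_mult_def sum scale
    by (intro sum.cong refl) (simp add: ga_extend_elem assms)
qed

lemma ga_mult_elem:
  assumes "finite (carrier G)" "g \<in> carrier G" "h \<in> carrier G"
  shows "ga_mult G (group_elem g) (group_elem h) = (group_elem (g \<otimes> h) :: 'a \<Rightarrow> 'f::field)"
proof -
  have "ga_mult G (group_elem g) (group_elem h) =
     (\<Sum>g'\<in>carrier G. if g' = g then
        (\<Sum>h'\<in>carrier G. if h' = h then group_elem (g \<otimes> h) else 0) else (0 :: 'a \<Rightarrow> 'f))"
    unfolding ga_mult_def
    by (intro sum.cong refl)
      (auto simp: group_elem_def fun_scale_def fun_eq_iff sum_fun_apply intro!: sum.cong)
  then show ?thesis using assms by simp
qed

lemma ga_mult_assoc:
  fixes x y z :: "'a \<Rightarrow> 'f::field"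
  assumes fin: "finite (carrier G)"
  shows "ga_mult G (ga_mult G x y) z = ga_mult G x (ga_mult G y z)"
proof -
  let ?C = "carrier G"
  have l: "ga_mult G u w = ga_extend G ga_scale (\<lambda>g. \<Sum>h\<in>?C. ga_scale (w h) (group_elem (g \<otimes> h))) u"
    for u w :: "'a \<Rightarrow> 'f"
    by (simp add: ga_mult_def ga_extend_def fun_scale_def fun_eq_iff sum_fun_apply
        sum_distrib_left mult.assoc)
  have r: "ga_mult G u w = ga_extend G ga_scale (\<lambda>h. \<Sum>g\<in>?C. ga_scale (u g) (group_elem (g \<otimes> h))) w"
    for u w :: "'a \<Rightarrow> 'f"
    by (subst ga_mult_def, subst sum.swap)
      (simp add: ga_extend_def fun_scale_def fun_eq_iff sum_fun_apply
        sum_distrib_left mult.assoc mult.left_commute)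
  have "ga_mult G (ga_mult G x y) z =
     (\<Sum>g\<in>?C. \<Sum>h\<in>?C. ga_scale (x g * y h) (\<Sum>k\<in>?C. ga_scale (z k) (group_elem (g \<otimes> h \<otimes> k))))"
    by (subst l, rule ga_extend_mult[OF vector_space_ga_scale fin])
  also have "\<dots> = (\<Sum>g\<in>?C. \<Sum>h\<in>?C. \<Sum>k\<in>?C. ga_scale (x g * y h * z k) (group_elem (g \<otimes> (h \<otimes> k))))"
    by (intro sum.cong refl)
      (auto simp: fun_scale_def fun_eq_iff sum_fun_apply sum_distrib_left mult.assoc m_assoc
        intro!: sum.cong)
  also have "\<dots> = (\<Sum>h\<in>?C. \<Sum>k\<in>?C. \<Sum>g\<in>?C. ga_scale (x g * y h * z k) (group_elem (g \<otimes> (h \<otimes> k))))"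
    by (subst sum.swap, rule sum.cong[OF refl], rule sum.swap)
  also have "\<dots> = (\<Sum>h\<in>?C. \<Sum>k\<in>?C. ga_scale (y h * z k)
      (\<Sum>g\<in>?C. ga_scale (x g) (group_elem (g \<otimes> (h \<otimes> k)))))"
    by (simp add: fun_scale_def fun_eq_iff sum_fun_apply sum_distrib_left mult_ac)
  also have "\<dots> = ga_mult G x (ga_mult G y z)"
    by (subst r[of x], rule ga_extend_mult[OF vector_space_ga_scale fin, symmetric])
  finally show ?thesis .
qed

lemma subspace_plesken: "module.subspace ga_scale (plesken G :: ('a \<Rightarrow> 'f::field) set)"
proof -
  interpret vector_space "ga_scale :: 'f \<Rightarrow> ('a \<Rightarrow> 'f) \<Rightarrow> _" by (rule vector_space_ga_scale)
  show ?thesis unfolding plesken_def by (rule subspace_span)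
qed

lemma plesken_subset: "(plesken G :: ('a \<Rightarrow> 'f::field) set) \<subseteq> group_algebra G"
proof -
  interpret vector_space "ga_scale :: 'f \<Rightarrow> ('a \<Rightarrow> 'f) \<Rightarrow> _" by (rule vector_space_ga_scale)
  show ?thesis
    unfolding plesken_def
    by (rule span_minimal[OF _ subspace_group_algebra])
      (auto simp: group_hat_def intro!: subspace_diff[OF subspace_group_algebra] group_elem_closed)
qed

lemma plesken_bracket_hat:
  assumes "finite (carrier G)" "g \<in> carrier G" "h \<in> carrier G"
  shows "plesken_bracket G (group_hat G g) (group_hat G h) =
    (group_hat G (g \<otimes> h) - group_hat G (g \<otimes> inv h) - group_hat G (inv g \<otimes> h)
      + group_hat G (inv g \<otimes> inv h) :: 'a \<Rightarrow> 'f::field)"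
proof -
  have dl: "ga_mult G (x - y) z = ga_mult G x z - ga_mult G y z" for x y z :: "'a \<Rightarrow> 'f"
    using ga_mult_add_left[of G "x - y" y z] by simp
  have dr: "ga_mult G x (y - z) = ga_mult G x y - ga_mult G x z" for x y z :: "'a \<Rightarrow> 'f"
    using ga_mult_add_right[of G x "y - z" z] by simp
  show ?thesis
    using assms
    by (simp add: plesken_bracket_def commutator_def group_hat_def dl dr ga_mult_elem
        inv_mult_group algebra_simps)
qed

lemma plesken_bracket_closed:
  fixes x y :: "'a \<Rightarrow> 'f::field"
  assumes fin: "finite (carrier G)" and "x \<in> plesken G" "y \<in> plesken G"
  shows "plesken_bracket G x y \<in> plesken G"
proof -
  interpret vector_space "ga_scale :: 'f \<Rightarrow> ('a \<Rightarrow> 'f) \<Rightarrow> _" by (rule vector_space_ga_scale)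
  note sub = subspace_plesken[where 'f = 'f]
  have hat: "(group_hat G g :: 'a \<Rightarrow> 'f) \<in> plesken G" if "g \<in> carrier G" for g
    unfolding plesken_def using that by (auto intro: span_base)
  have lin1: "plesken_bracket G (u + v) w = plesken_bracket G u w + plesken_bracket G v w"
    "plesken_bracket G (ga_scale c u) w = ga_scale c (plesken_bracket G u w)"
    "plesken_bracket G 0 w = 0"
    "plesken_bracket G w (u + v) = plesken_bracket G w u + plesken_bracket G w v"
    "plesken_bracket G w (ga_scale c u) = ga_scale c (plesken_bracket G w u)"
    "plesken_bracket G w 0 = 0" for u v w :: "'a \<Rightarrow> 'f" and c
    by (simp_all add: plesken_bracket_def commutator_def ga_mult_add_left ga_mult_add_right
        ga_mult_scale_left ga_mult_scale_right scale_right_diff_distrib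
        ga_mult_add_left[of G 0 0, simplified] ga_mult_add_right[of G _ 0 0, simplified])
  have 1: "plesken_bracket G (group_hat G g) y \<in> plesken G" if g: "g \<in> carrier G" for g
    using \<open>y \<in> plesken G\<close>[unfolded plesken_def]
  proof (induction rule: span_induct_alt)
    case base
    show ?case unfolding lin1 by (rule subspace_0[OF sub])
  next
    case (step c z w)
    then obtain h where h: "h \<in> carrier G" "z = group_hat G h" by auto
    have "plesken_bracket G (group_hat G g) z \<in> plesken G"
      unfolding h(2) plesken_bracket_hat[OF fin g h(1)]
      using g h(1) by (intro subspace_diff[OF sub] subspace_add[OF sub] hat) auto
    then show ?case
      unfolding lin1 by (intro subspace_add[OF sub] subspace_scale[OF sub] step.IH)
  qed
  show ?thesis
    using \<open>x \<in> plesken G\<close>[unfolded plesken_def]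
  proof (induction rule: span_induct_alt)
    case base
    show ?case unfolding lin1 by (rule subspace_0[OF sub])
  next
    case (step c z w)
    have "plesken_bracket G z y \<in> plesken G"
      using step.hyps 1 by auto
    then show ?case
      unfolding lin1 by (intro subspace_add[OF sub] subspace_scale[OF sub] step.IH)
  qed
qed

lemma lie_algebra_plesken:
  assumes "finite (carrier G)"
  shows "lie_algebra ga_scale (plesken G :: ('a \<Rightarrow> 'f::field) set) (plesken_bracket G)"
  unfolding plesken_bracket_def
  using plesken_bracket_closed[OF assms, unfolded plesken_bracket_def]
  by (intro lie_algebra_commutatorI[OF vector_space_ga_scale subspace_group_algebra
        subspace_plesken plesken_subset])
    (auto simp: ga_mult_closed ga_mult_add_left ga_mult_add_right ga_mult_scale_left
      ga_mult_scale_right ga_mult_assoc[OF assms])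

lemma plesken_imp_sum:
  fixes x :: "'a \<Rightarrow> 'f::field"
  assumes fin: "finite (carrier G)" and "x \<in> plesken G"
  obtains a where "x = (\<Sum>g\<in>carrier G. ga_scale (a g) (group_hat G g))"
proof -
  interpret vector_space "ga_scale :: 'f \<Rightarrow> ('a \<Rightarrow> 'f) \<Rightarrow> _" by (rule vector_space_ga_scale)
  let ?S = "\<lambda>a. \<Sum>g\<in>carrier G. ga_scale (a g) (group_hat G g) :: 'a \<Rightarrow> 'f"
  have "\<exists>a. x = ?S a"
    using \<open>x \<in> plesken G\<close>[unfolded plesken_def]
  proof (induction rule: span_induct_alt)
    case base
    show ?case by (rule exI[of _ "\<lambda>_. 0"]) simp
  next
    case (step c z w)
    then obtain h a where h: "h \<in> carrier G" "z = group_hat G h" and a: "w = ?S a" by auto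
    have "?S (\<lambda>g. (if g = h then c else 0) + a g) =
        (\<Sum>g\<in>carrier G. (if g = h then ga_scale c (group_hat G h) else 0)) + ?S a"
      unfolding scale_left_distrib sum.distrib by (auto intro!: sum.cong)
    then have "ga_scale c z + w = ?S (\<lambda>g. (if g = h then c else 0) + a g)"
      using fin h a by simp
    from exI[of "\<lambda>b. ga_scale c z + w = ?S b", OF this] show ?case .
  qed
  then show ?thesis using that by blast
qed

end

context
  fixes G :: "('g, 'm) monoid_scheme" (structure)
    and s :: "'f::field \<Rightarrow> 'v::ab_group_add \<Rightarrow> 'v"
    and \<rho> :: "'g \<Rightarrow> 'v \<Rightarrow> 'v"
  assumes G: "group G" and fin: "finite (carrier G)" and vs: "vector_space s"
    and rep: "group_representation G s \<rho>"
begin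

interpretation group G by (fact G)
interpretation V: vector_space s by (fact vs)
interpretation E: vector_space "fun_scale s :: 'f \<Rightarrow> ('v \<Rightarrow> 'v) \<Rightarrow> 'v \<Rightarrow> 'v"
  using vs by (rule vector_space_fun_scale)

lemma group_general_linear_group: "group (general_linear_group s)"
proof (rule groupI)
  fix T assume "T \<in> carrier (general_linear_group s)"
  then have T: "Vector_Spaces.linear s s T" "bij T" by (auto simp: general_linear_group_def)
  have "Vector_Spaces.linear s s (Hilbert_Choice.inv T)"
    using T by (auto simp: Vector_Spaces.linear_iff bij_is_surj surj_f_inv_f inv_f_eq[OF bij_is_inj])
  moreover have "Hilbert_Choice.inv T \<circ> T = id"
    using T(2) by (simp add: bij_is_inj)
  ultimately show "\<exists>S\<in>carrier (general_linear_group s).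
      S \<otimes>\<^bsub>general_linear_group s\<^esub> T = \<one>\<^bsub>general_linear_group s\<^esub>"
    using T(2) bij_imp_bij_inv by (auto simp: general_linear_group_def)
qed (auto simp: general_linear_group_def Vector_Spaces.linear_iff vs o_assoc intro: bij_comp)

lemma representation_facts:
  assumes "g \<in> carrier G"
  shows "\<rho> g \<in> gl s"
    and "h \<in> carrier G \<Longrightarrow> \<rho> (g \<otimes> h) = \<rho> g \<circ> \<rho> h"
    and "GL_hat s (\<rho> g) = \<rho> g - \<rho> (inv g)"
proof -
  have hom: "\<rho> \<in> hom G (general_linear_group s)"
    using rep by (simp add: group_representation_def)
  then interpret group_hom G "general_linear_group s" \<rho>
    by (simp add: group_hom_def group_hom_axioms_def G group_general_linear_group)
  show "\<rho> g \<in> gl s"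
    using hom_closed[OF assms] by (simp add: general_linear_group_def gl_def)
  show "h \<in> carrier G \<Longrightarrow> \<rho> (g \<otimes> h) = \<rho> g \<circ> \<rho> h"
    using hom_mult[OF assms] by (simp add: general_linear_group_def)
  show "GL_hat s (\<rho> g) = \<rho> g - \<rho> (inv g)"
    using assms by (simp add: GL_hat_def)
qed

lemma ga_extend_sum_hat:
  "ga_extend G (fun_scale s) \<rho> (\<Sum>g\<in>carrier G. ga_scale (a g) (group_hat G g)) =
    (\<Sum>g\<in>carrier G. fun_scale s (a g) (GL_hat s (\<rho> g)))"
proof -
  interpret Vector_Spaces.linear ga_scale "fun_scale s" "ga_extend G (fun_scale s) \<rho>"
    by (rule linear_ga_extend) unfold_locales
  show ?thesis
    unfolding sum scale
    by (intro sum.cong refl)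
      (simp add: group_hat_def diff ga_extend_elem[OF E.vector_space_axioms fin]
        representation_facts(3))
qed

lemma plesken_rep_sum:
  "plesken_rep G s \<rho> (\<Sum>g\<in>carrier G. ga_scale (a g) (group_hat G g)) =
    (\<Sum>g\<in>carrier G. fun_scale s (a g) (GL_hat s (\<rho> g)))"
  unfolding plesken_rep_def
proof (rule the_equality)
  fix T
  assume "\<exists>b. (\<Sum>g\<in>carrier G. ga_scale (a g) (group_hat G g)) =
        (\<Sum>g\<in>carrier G. ga_scale (b g) (group_hat G g)) \<and>
      T = (\<Sum>g\<in>carrier G. fun_scale s (b g) (GL_hat s (\<rho> g)))"
  then show "T = (\<Sum>g\<in>carrier G. fun_scale s (a g) (GL_hat s (\<rho> g)))"
    by (metis ga_extend_sum_hat)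
qed blast

lemma lie_representation_plesken_rep:
  "lie_representation ga_scale (plesken G) (plesken_bracket G) s (plesken_rep G s \<rho>)"
proof -
  let ?P = "ga_extend G (fun_scale s) \<rho>"
  interpret L: lie_algebra ga_scale "plesken G :: ('g \<Rightarrow> 'f) set" "plesken_bracket G"
    by (rule lie_algebra_plesken) (fact fin)
  interpret P: Vector_Spaces.linear ga_scale "fun_scale s" ?P
    by (rule linear_ga_extend) unfold_locales
  interpret M: lie_algebra "fun_scale s" "gl s" "commutator (\<circ>)"
    by (rule lie_algebra_gl) (fact vs)
  have eq: "plesken_rep G s \<rho> x = ?P x" if x: "x \<in> plesken G" for x
  proof -
    obtain a where "x = (\<Sum>g\<in>carrier G. ga_scale (a g) (group_hat G g))"
      using plesken_imp_sum[OF fin x] .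
    then show ?thesis by (simp add: plesken_rep_sum ga_extend_sum_hat)
  qed
  have lin: "T (\<Sum>i\<in>A. f i) = (\<Sum>i\<in>A. T (f i))" "T (s c v) = s c (T v)"
    if "T \<in> gl s" for T c v and A :: "'g set" and f
    using that module_hom.sum[of s s T] module_hom.scale[of s s T]
    by (auto simp: gl_def module_hom_iff_linear)
  have mult: "?P (ga_mult G x y) = ?P x \<circ> ?P y" for x y
  proof -
    have "?P (ga_mult G x y) =
        (\<Sum>g\<in>carrier G. \<Sum>h\<in>carrier G. fun_scale s (x g * y h) (\<rho> g \<circ> \<rho> h))"
      unfolding ga_extend_mult[OF E.vector_space_axioms fin]
      by (intro sum.cong refl) (simp add: representation_facts(2))
    also have "\<dots> = ?P x \<circ> ?P y"
      unfolding ga_extend_def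
      by (auto simp: fun_eq_iff sum_fun_apply fun_scale_def lin representation_facts(1)
          V.scale_sum_right intro!: sum.cong)
    finally show ?thesis .
  qed
  have "lie_algebra_hom ga_scale (plesken G) (plesken_bracket G)
      (fun_scale s) (gl s) (commutator (\<circ>)) (plesken_rep G s \<rho>)"
  proof unfold_locales
    fix x y :: "'g \<Rightarrow> 'f" and c
    assume x: "x \<in> plesken G"
    show "plesken_rep G s \<rho> x \<in> gl s"
      unfolding eq[OF x] ga_extend_def
      by (intro E.subspace_sum E.subspace_scale M.subspace_L representation_facts(1))
    show "plesken_rep G s \<rho> (ga_scale c x) = fun_scale s c (plesken_rep G s \<rho> x)"
      using x by (simp add: eq L.subspace_scale[OF L.subspace_L] P.scale)
    assume y: "y \<in> plesken G"
    show "plesken_rep G s \<rho> (x + y) = plesken_rep G s \<rho> x + plesken_rep G s \<rho> y"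
      using x y by (simp add: eq L.subspace_add[OF L.subspace_L] P.add)
    have "?P (plesken_bracket G x y) = commutator (\<circ>) (?P x) (?P y)"
      by (simp add: plesken_bracket_def commutator_def P.diff mult)
    then show "plesken_rep G s \<rho> (plesken_bracket G x y) =
        commutator (\<circ>) (plesken_rep G s \<rho> x) (plesken_rep G s \<rho> y)"
      using x y by (simp add: eq L.br_closed)
  qed
  then show ?thesis by (simp add: lie_representation_def)
qed

end

end

theory Submission
  imports Defs
begin

text \<open>
  Any subspace \<open>W\<close> that is stable under the group is stable under the Plesken Lie algebra: an element
  of the latter acts as a linear combination of operators \<open>\<rho> g - \<rho> (inv g)\<close>, and both terms
  of such a difference preserve \<open>W\<close>, because \<open>inv g\<close> is again an element of the group. So a subspace that
  witnesses reducibility of the group representation serves unchanged for the Lie algebra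
  representation.
\<close>

lemma invariant_subspace_plesken_rep:
  fixes s :: "'f::field \<Rightarrow> 'v::ab_group_add \<Rightarrow> 'v"
  assumes G: "group G" and fin: "finite (carrier G)" and vs: "vector_space s"
    and rep: "group_representation G s \<rho>"
    and inv: "invariant_subspace s (\<rho> ` carrier G) W"
  shows "invariant_subspace s (plesken_rep G s \<rho> ` plesken G) W"
proof -
  interpret group G by (fact G)
  interpret vector_space s by (fact vs)
  have W: "subspace W"
    using inv by (simp add: invariant_subspace_def)
  have \<rho>W: "\<rho> g w \<in> W" if "g \<in> carrier G" "w \<in> W" for g w
    using inv that by (auto simp: invariant_subspace_def)
  have hat: "GL_hat s (\<rho> g) w \<in> W" if "g \<in> carrier G" "w \<in> W" for g w
    using that representation_facts(3)[OF G fin vs rep]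
    by (auto intro: subspace_diff[OF W] \<rho>W)
  have "plesken_rep G s \<rho> x w \<in> W" if x: "x \<in> plesken G" and w: "w \<in> W" for x w
  proof -
    obtain a where "x = (\<Sum>g\<in>carrier G. ga_scale (a g) (group_hat G g))"
      using plesken_imp_sum[OF fin x] .
    then have "plesken_rep G s \<rho> x w = (\<Sum>g\<in>carrier G. s (a g) (GL_hat s (\<rho> g) w))"
      by (simp only: plesken_rep_sum[OF G fin vs rep] sum_fun_apply fun_scale_def[of s])
    also have "\<dots> \<in> W"
      by (intro subspace_sum[OF W] subspace_scale[OF W] hat w)
    finally show ?thesis .
  qed
  with W show ?thesis
    by (auto simp: invariant_subspace_def)
qed

theorem theorem2:
  fixes G :: "('g, 'm) monoid_scheme"
    and scale :: "'f::field_char_0 \<Rightarrow> 'v::ab_group_add \<Rightarrow> 'v"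
    and Basis :: "'v set"
    and \<rho> :: "'g \<Rightarrow> 'v \<Rightarrow> 'v"
  assumes "group G" and "finite (carrier G)"
    and "finite_dimensional_vector_space scale Basis"
    and "reducible_group_representation G scale \<rho>"
  shows "reducible_lie_representation ga_scale (plesken G) (plesken_bracket G)
           scale (plesken_rep G scale \<rho>)"
proof -
  have vs: "vector_space scale"
    using assms(3) by (simp add: finite_dimensional_vector_space_def)
  from assms(4) obtain W where rep: "group_representation G scale \<rho>"
    and W: "invariant_subspace scale (\<rho> ` carrier G) W" "W \<noteq> {0}" "W \<noteq> UNIV"
    by (auto simp: reducible_group_representation_def)
  show ?thesis
    unfolding reducible_lie_representation_def
    using lie_representation_plesken_rep[OF assms(1,2) vs rep]
      invariant_subspace_plesken_rep[OF assms(1,2) vs rep W(1)] W(2,3)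
    by blast
qed

end
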